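(* For measurable $\theta:\Xi\to[0,+\infty)$ with $\int_\Xi e^{\theta(x)}p(x)\,\mathrm{d}x<+\infty$ put $G(\theta)=\ln\left(\int_\Xi e^{\theta(x)}p(x)\,\mathrm{d}x\right)$. For any such $\theta_1,\theta_2$ and any real number $\kappa\in[0,1]$, $$G(\kappa\theta_1+(1-\kappa)\theta_2)\le\kappa G(\theta_1)+(1-\kappa)G(\theta_2).$$ Furthermore, with $$H(u,w,c)=\mu\ln\left(\int_\Xi e^{\frac{F(x,u,w,c)}{\mu}}p(x)\,\mathrm{d}x\right),$$ for $u_i,w_i\ge 0$, $c_i\in\mathfrak{C}$ ($i=1,2$) and $\kappa\in[0,1]$, $$H(\kappa u_1+(1-\kappa)u_2,\ \kappa w_1+(1-\kappa)w_2,\ \kappa c_1+(1-\kappa)c_2)\le\kappa H(u_1,w_1,c_1)+(1-\kappa)H(u_2,w_2,c_2).$$ Consequently, the optimization problem $\inf_{u,w\ge 0,\,c\in\mathfrak{C}}\left\{-\lambda u+\eta w+H(u,w,c)\right\}$ is convex, i.e. it minimizes a convex objective over the convex set $[0,+\infty)^2\times\mathfrak{C}$.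
   Context: Fix $\underline{X}\ge 0$ and $\Xi=(\underline{X},+\infty)$; $p$ is a bounded continuous probability density function that is positive on $\Xi$, with $\int_\Xi p(x)\,\mathrm{d}x=1$. $L_p^2(\Xi)$ is the Hilbert space with norm $\|c\|=\sqrt{\int_\Xi c^2(x)p(x)\,\mathrm{d}x}$, and $\mathfrak{C}=\{c:\Xi\to[0,1]\ \text{measurable},\ c\in L_p^2(\Xi)\}$. Constants: $\alpha,\beta\in(0,1)$, $\hat{c}\in[0,1]$, $\lambda,\eta\ge 0$, $\mu>0$. The function $g:[0,1]\to[0,+\infty)$ is twice continuously differentiable, increasing, strictly convex and Lipschitz continuous. Define $$F(x,u,w,c)=g(|c(x)-\hat{c}|)+\frac{\lambda}{\alpha}\max\{u-(1-c(x))x,0\}+\frac{\eta}{1-\beta}\max\{(1-c(x))x-w,0\}.$$ Standing assumption: $C_X=\frac{2\eta}{\mu(1-\beta)}>0$ is small enough that $\int_\Xi x^k e^{C_X x}p(x)\,\mathrm{d}x<+\infty$ for $k=0,1,2$. *)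

theory Defs
  imports "HOL-Analysis.Analysis" "HOL-Library.Function_Algebras"
begin

text \<open>Functions into a real vector space form a real vector space under the pointwise
  operations, so that \<^const>\<open>convex\<close> and \<^const>\<open>convex_on\<close> apply to sets of functions.\<close>

instantiation "fun" :: (type, scaleR) scaleR
begin
definition scaleR_fun_def: "r *\<^sub>R f = (\<lambda>x. r *\<^sub>R f x)"
instance ..
end

lemma scaleR_fun_apply [simp]: "(r *\<^sub>R f) x = r *\<^sub>R f x"
  by (simp add: scaleR_fun_def)

instance "fun" :: (type, real_vector) real_vector
  by standard (simp_all add: fun_eq_iff scaleR_add_right scaleR_add_left)

definition strictly_convex_on :: "'a::real_vector set \<Rightarrow> ('a \<Rightarrow> real) \<Rightarrow> bool" where
  "strictly_convex_on S f \<longleftrightarrow> convex S \<and>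
     (\<forall>x\<in>S. \<forall>y\<in>S. x \<noteq> y \<longrightarrow>
        (\<forall>u>0. \<forall>v>0. u + v = 1 \<longrightarrow> f (u *\<^sub>R x + v *\<^sub>R y) < u * f x + v * f y))"

text \<open>Derivatives are taken within \<open>S\<close>: one-sided at the end points of a closed interval.\<close>

definition C2_on :: "real set \<Rightarrow> (real \<Rightarrow> real) \<Rightarrow> bool" where
  "C2_on S g \<longleftrightarrow> (\<exists>g' g''.
     (\<forall>x\<in>S. (g has_real_derivative g' x) (at x within S)) \<and>
     (\<forall>x\<in>S. (g' has_real_derivative g'' x) (at x within S)) \<and>
     continuous_on S g'')"

text \<open>Functions on \<open>\<Xi> = {X<..}\<close> are represented by total functions \<^typ>\<open>real \<Rightarrow> real\<close>; every condition
  and every integral refers to \<open>\<Xi>\<close> only, so values outside \<open>\<Xi>\<close> are irrelevant. Measurability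
  is Lebesgue measurability, and functions are not identified up to null sets.\<close>

definition L2p :: "real \<Rightarrow> (real \<Rightarrow> real) \<Rightarrow> (real \<Rightarrow> real) set" where
  "L2p X p = {c. c \<in> borel_measurable (lebesgue_on {X<..}) \<and>
                 integrable (lebesgue_on {X<..}) (\<lambda>x. (c x)\<^sup>2 * p x)}"

definition contracts :: "real \<Rightarrow> (real \<Rightarrow> real) \<Rightarrow> (real \<Rightarrow> real) set" where
  "contracts X p = {c. c \<in> borel_measurable (lebesgue_on {X<..}) \<and>
                       (\<forall>x\<in>{X<..}. 0 \<le> c x \<and> c x \<le> 1) \<and> c \<in> L2p X p}"

definition G_dom :: "real \<Rightarrow> (real \<Rightarrow> real) \<Rightarrow> (real \<Rightarrow> real) set" where
  "G_dom X p = {\<theta>. \<theta> \<in> borel_measurable (lebesgue_on {X<..}) \<and>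
                    (\<forall>x\<in>{X<..}. 0 \<le> \<theta> x) \<and>
                    integrable (lebesgue_on {X<..}) (\<lambda>x. exp (\<theta> x) * p x)}"

definition G :: "real \<Rightarrow> (real \<Rightarrow> real) \<Rightarrow> (real \<Rightarrow> real) \<Rightarrow> real" where
  "G X p \<theta> = ln (LINT x|lebesgue_on {X<..}. exp (\<theta> x) * p x)"

definition F :: "(real \<Rightarrow> real) \<Rightarrow> real \<Rightarrow> real \<Rightarrow> real \<Rightarrow> real \<Rightarrow> real \<Rightarrow>
    real \<Rightarrow> real \<Rightarrow> real \<Rightarrow> (real \<Rightarrow> real) \<Rightarrow> real" where
  "F g chat \<alpha> \<beta> lam \<eta> x u w c =
     g \<bar>c x - chat\<bar> + lam / \<alpha> * max (u - (1 - c x) * x) 0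
       + \<eta> / (1 - \<beta>) * max ((1 - c x) * x - w) 0"

definition H :: "real \<Rightarrow> (real \<Rightarrow> real) \<Rightarrow> (real \<Rightarrow> real) \<Rightarrow> real \<Rightarrow> real \<Rightarrow> real \<Rightarrow> real \<Rightarrow> real \<Rightarrow> real \<Rightarrow>
    real \<Rightarrow> real \<Rightarrow> (real \<Rightarrow> real) \<Rightarrow> real" where
  "H X p g chat \<alpha> \<beta> lam \<eta> \<mu> u w c =
     \<mu> * ln (LINT x|lebesgue_on {X<..}. exp (F g chat \<alpha> \<beta> lam \<eta> x u w c / \<mu>) * p x)"

definition feasible :: "real \<Rightarrow> (real \<Rightarrow> real) \<Rightarrow> (real \<times> real \<times> (real \<Rightarrow> real)) set" where
  "feasible X p = {0..} \<times> {0..} \<times> contracts X p"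

definition objective :: "real \<Rightarrow> (real \<Rightarrow> real) \<Rightarrow> (real \<Rightarrow> real) \<Rightarrow> real \<Rightarrow> real \<Rightarrow> real \<Rightarrow> real \<Rightarrow> real \<Rightarrow> real \<Rightarrow>
    real \<times> real \<times> (real \<Rightarrow> real) \<Rightarrow> real" where
  "objective X p g chat \<alpha> \<beta> lam \<eta> \<mu> =
     (\<lambda>(u, w, c). - lam * u + \<eta> * w + H X p g chat \<alpha> \<beta> lam \<eta> \<mu> u w c)"

end

theory Submission
  imports Defs
begin

text \<open>Convexity of the log-exponential functional is Hoelder's inequality with exponents \<open>1/\<kappa>\<close> and
  \<open>1/(1 - \<kappa>)\<close>. It is obtained here from the convexity of \<open>exp\<close> alone, after shifting \<open>\<theta>\<^sub>1\<close> and \<open>\<theta>\<^sub>2\<close> by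
  constants so that both exponential integrals equal \<open>1\<close>. The functional \<open>H\<close> is \<open>\<mu> * G (F / \<mu>)\<close>, and
  \<open>F\<close> is pointwise jointly convex because \<open>g\<close> is convex and increasing; monotonicity of the
  logarithm and the integral concludes.\<close>

section \<open>Convexity and monotonicity of the log-exponential functional \<open>G\<close>\<close>

lemma exp_convex_combination_le:
  fixes a b \<kappa> :: real
  assumes "0 \<le> \<kappa>" "\<kappa> \<le> 1"
  shows "exp (\<kappa> * a + (1 - \<kappa>) * b) \<le> \<kappa> * exp a + (1 - \<kappa>) * exp b"
  using convex_onD[OF exp_convex, of "1 - \<kappa>" a b] assms by simp

text \<open>Convexity of \<open>exp\<close> dominates the integrand by a convex combination of two
  integrable ones. This gives closure of \<open>G_dom\<close> under convex combinations, and it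
  makes \<open>integral_mono\<close> applicable, since a non-integrable function would have integral
  0 by default.\<close>

lemma integrable_exp_convex_combination:
  fixes \<theta>\<^sub>1 \<theta>\<^sub>2 p :: "'a \<Rightarrow> real"
  assumes "\<And>x. x \<in> space M \<Longrightarrow> 0 \<le> p x"
    and [measurable]: "\<theta>\<^sub>1 \<in> borel_measurable M" "\<theta>\<^sub>2 \<in> borel_measurable M" "p \<in> borel_measurable M"
    and "integrable M (\<lambda>x. exp (\<theta>\<^sub>1 x) * p x)" "integrable M (\<lambda>x. exp (\<theta>\<^sub>2 x) * p x)"
    and "0 \<le> \<kappa>" "\<kappa> \<le> 1"
  shows "integrable M (\<lambda>x. exp (\<kappa> * \<theta>\<^sub>1 x + (1 - \<kappa>) * \<theta>\<^sub>2 x) * p x)"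
proof (rule Bochner_Integration.integrable_bound)
  show "integrable M (\<lambda>x. \<kappa> * (exp (\<theta>\<^sub>1 x) * p x) + (1 - \<kappa>) * (exp (\<theta>\<^sub>2 x) * p x))"
    using assms by simp
  show "AE x in M. norm (exp (\<kappa> * \<theta>\<^sub>1 x + (1 - \<kappa>) * \<theta>\<^sub>2 x) * p x)
          \<le> norm (\<kappa> * (exp (\<theta>\<^sub>1 x) * p x) + (1 - \<kappa>) * (exp (\<theta>\<^sub>2 x) * p x))"
  proof (rule AE_I2)
    fix x assume x: "x \<in> space M"
    have "exp (\<kappa> * \<theta>\<^sub>1 x + (1 - \<kappa>) * \<theta>\<^sub>2 x) * p x
        \<le> (\<kappa> * exp (\<theta>\<^sub>1 x) + (1 - \<kappa>) * exp (\<theta>\<^sub>2 x)) * p x"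
      using exp_convex_combination_le assms x by (intro mult_right_mono) auto
    then show "norm (exp (\<kappa> * \<theta>\<^sub>1 x + (1 - \<kappa>) * \<theta>\<^sub>2 x) * p x)
          \<le> norm (\<kappa> * (exp (\<theta>\<^sub>1 x) * p x) + (1 - \<kappa>) * (exp (\<theta>\<^sub>2 x) * p x))"
      using assms(1)[OF x] by (simp add: algebra_simps)
  qed
qed measurable

text \<open>Positivity of the first two integrals allows normalising by them, positivity of the
  third allows taking logarithms at the end. As no conjugate exponents occur, the end points
  \<kappa> = 0 and \<kappa> = 1 need no separate treatment.\<close>

lemma ln_integral_exp_convex:
  fixes \<theta>\<^sub>1 \<theta>\<^sub>2 p :: "'a \<Rightarrow> real"
  assumes p: "\<And>x. x \<in> space M \<Longrightarrow> 0 \<le> p x"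
    and meas: "\<theta>\<^sub>1 \<in> borel_measurable M" "\<theta>\<^sub>2 \<in> borel_measurable M" "p \<in> borel_measurable M"
    and int: "integrable M (\<lambda>x. exp (\<theta>\<^sub>1 x) * p x)" "integrable M (\<lambda>x. exp (\<theta>\<^sub>2 x) * p x)"
    and pos: "0 < (LINT x|M. exp (\<theta>\<^sub>1 x) * p x)" "0 < (LINT x|M. exp (\<theta>\<^sub>2 x) * p x)"
      "0 < (LINT x|M. exp (\<kappa> * \<theta>\<^sub>1 x + (1 - \<kappa>) * \<theta>\<^sub>2 x) * p x)"
    and \<kappa>: "0 \<le> \<kappa>" "\<kappa> \<le> 1"
  shows "ln (LINT x|M. exp (\<kappa> * \<theta>\<^sub>1 x + (1 - \<kappa>) * \<theta>\<^sub>2 x) * p x)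
    \<le> \<kappa> * ln (LINT x|M. exp (\<theta>\<^sub>1 x) * p x) + (1 - \<kappa>) * ln (LINT x|M. exp (\<theta>\<^sub>2 x) * p x)"
proof -
  define A where "A = (LINT x|M. exp (\<theta>\<^sub>1 x) * p x)"
  define B where "B = (LINT x|M. exp (\<theta>\<^sub>2 x) * p x)"
  \<comment> \<open>\<open>exp L\<close> is the Hoelder bound, the product of \<open>A\<close> to
    the power \<kappa> and \<open>B\<close> to the power 1 - \<kappa>. The shifts by
    \<open>ln A\<close> and \<open>ln B\<close> below pull exactly this factor out of the
    exponential.\<close>
  define L where "L = \<kappa> * ln A + (1 - \<kappa>) * ln B"
  have AB: "A > 0" "B > 0" using pos by (simp_all add: A_def B_def)
  have le: "exp (\<kappa> * \<theta>\<^sub>1 x + (1 - \<kappa>) * \<theta>\<^sub>2 x) * p x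
      \<le> exp L * (\<kappa> / A * (exp (\<theta>\<^sub>1 x) * p x) + (1 - \<kappa>) / B * (exp (\<theta>\<^sub>2 x) * p x))"
    if x: "x \<in> space M" for x
  proof -
    have "exp (\<kappa> * \<theta>\<^sub>1 x + (1 - \<kappa>) * \<theta>\<^sub>2 x)
        = exp L * exp (\<kappa> * (\<theta>\<^sub>1 x - ln A) + (1 - \<kappa>) * (\<theta>\<^sub>2 x - ln B))"
      unfolding exp_add[symmetric] L_def by (simp add: algebra_simps)
    also have "\<dots> \<le> exp L * (\<kappa> * exp (\<theta>\<^sub>1 x - ln A) + (1 - \<kappa>) * exp (\<theta>\<^sub>2 x - ln B))"
      using exp_convex_combination_le[OF \<kappa>] by (intro mult_left_mono) auto
    also have "\<dots> = exp L * (\<kappa> / A * exp (\<theta>\<^sub>1 x) + (1 - \<kappa>) / B * exp (\<theta>\<^sub>2 x))"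
      using AB by (simp add: exp_diff)
    finally show ?thesis
      using mult_right_mono[OF _ p[OF x]] by (fastforce simp: algebra_simps)
  qed
  have "(LINT x|M. exp (\<kappa> * \<theta>\<^sub>1 x + (1 - \<kappa>) * \<theta>\<^sub>2 x) * p x)
      \<le> (LINT x|M. exp L * (\<kappa> / A * (exp (\<theta>\<^sub>1 x) * p x) + (1 - \<kappa>) / B * (exp (\<theta>\<^sub>2 x) * p x)))"
    using integrable_exp_convex_combination[OF p meas int \<kappa>] int le
    by (intro integral_mono) auto
  \<comment> \<open>After normalisation each exponential integrates to 1, so the bracket is just the
    sum of the weights.\<close>
  also have "\<dots> = exp L * (\<kappa> / A * A + (1 - \<kappa>) / B * B)"
    using int by (simp add: A_def B_def)
  also have "\<dots> = exp L" using AB by simp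
  finally have "ln (LINT x|M. exp (\<kappa> * \<theta>\<^sub>1 x + (1 - \<kappa>) * \<theta>\<^sub>2 x) * p x) \<le> L"
    using pos(3) by (metis ln_exp ln_le_cancel_iff exp_gt_zero)
  then show ?thesis by (simp add: L_def A_def B_def)
qed

lemma G_dom_convex_combination:
  assumes "\<forall>x\<in>{X<..}. 0 \<le> p x" "p \<in> borel_measurable (lebesgue_on {X<..})"
    and "\<theta>\<^sub>1 \<in> G_dom X p" "\<theta>\<^sub>2 \<in> G_dom X p" "0 \<le> \<kappa>" "\<kappa> \<le> 1"
  shows "(\<lambda>x. \<kappa> * \<theta>\<^sub>1 x + (1 - \<kappa>) * \<theta>\<^sub>2 x) \<in> G_dom X p"
  using assms integrable_exp_convex_combination[of "lebesgue_on {X<..}" p \<theta>\<^sub>1 \<theta>\<^sub>2 \<kappa>]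
  unfolding G_dom_def by auto

text \<open>Since \<theta> is nonnegative, \<open>exp (\<theta> x)\<close> is at least 1, so the
  integral is at least the total mass 1 of \<open>p\<close>.\<close>

lemma G_integral_pos:
  assumes "\<forall>x\<in>{X<..}. 0 \<le> p x" "integrable (lebesgue_on {X<..}) p"
    and "(LINT x|lebesgue_on {X<..}. p x) = 1" "\<theta> \<in> G_dom X p"
  shows "0 < (LINT x|lebesgue_on {X<..}. exp (\<theta> x) * p x)"
proof -
  have "p x \<le> exp (\<theta> x) * p x" if "x \<in> {X<..}" for x
    using mult_right_mono[of 1 "exp (\<theta> x)" "p x"] assms(1,4) that by (simp add: G_dom_def)
  then have "(LINT x|lebesgue_on {X<..}. p x) \<le> (LINT x|lebesgue_on {X<..}. exp (\<theta> x) * p x)"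
    using assms by (intro integral_mono) (auto simp: G_dom_def)
  then show ?thesis using assms by simp
qed

lemma G_convex:
  assumes "\<forall>x\<in>{X<..}. 0 \<le> p x" "integrable (lebesgue_on {X<..}) p"
    and "(LINT x|lebesgue_on {X<..}. p x) = 1"
    and "\<theta>\<^sub>1 \<in> G_dom X p" "\<theta>\<^sub>2 \<in> G_dom X p" "0 \<le> \<kappa>" "\<kappa> \<le> 1"
  shows "G X p (\<lambda>x. \<kappa> * \<theta>\<^sub>1 x + (1 - \<kappa>) * \<theta>\<^sub>2 x) \<le> \<kappa> * G X p \<theta>\<^sub>1 + (1 - \<kappa>) * G X p \<theta>\<^sub>2"
proof -
  have "(\<lambda>x. \<kappa> * \<theta>\<^sub>1 x + (1 - \<kappa>) * \<theta>\<^sub>2 x) \<in> G_dom X p"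
    using assms by (intro G_dom_convex_combination) auto
  from G_integral_pos[OF assms(1-3) this] show ?thesis
    unfolding G_def using assms G_integral_pos[OF assms(1-3)]
    by (intro ln_integral_exp_convex) (auto simp: G_dom_def)
qed

text \<open>Needed because \<open>F\<close> is convex rather than affine: \<open>F\<close> at a
  combined point is only bounded by the combination to which \<open>G_convex\<close>
  applies.\<close>

lemma G_mono:
  assumes "\<forall>x\<in>{X<..}. 0 \<le> p x" "integrable (lebesgue_on {X<..}) p"
    and "(LINT x|lebesgue_on {X<..}. p x) = 1"
    and "\<theta>\<^sub>1 \<in> G_dom X p" "\<theta>\<^sub>2 \<in> G_dom X p" "\<forall>x\<in>{X<..}. \<theta>\<^sub>1 x \<le> \<theta>\<^sub>2 x"
  shows "G X p \<theta>\<^sub>1 \<le> G X p \<theta>\<^sub>2"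
proof -
  have "(LINT x|lebesgue_on {X<..}. exp (\<theta>\<^sub>1 x) * p x) \<le> (LINT x|lebesgue_on {X<..}. exp (\<theta>\<^sub>2 x) * p x)"
    using assms by (intro integral_mono) (auto simp: G_dom_def intro: mult_right_mono)
  then show ?thesis
    unfolding G_def using G_integral_pos[OF assms(1-3)] assms(4,5) by simp
qed

section \<open>From \<open>G\<close> to \<open>H\<close>: convexity, bounds and measurability of the
  integrand \<open>F\<close>\<close>

lemma H_eq_G: "H X p g chat \<alpha> \<beta> lam \<eta> \<mu> u w c = \<mu> * G X p (\<lambda>x. F g chat \<alpha> \<beta> lam \<eta> x u w c / \<mu>)"
  by (simp add: H_def G_def)

text \<open>Strictness speaks only of distinct points and positive weights; in the remaining cases
  both sides agree.\<close>

lemma strictly_convex_on_imp_convex_on: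
  assumes "strictly_convex_on S f"
  shows "convex_on S f"
  unfolding convex_on_def
proof (intro conjI ballI allI impI)
  show "convex S" using assms by (simp add: strictly_convex_on_def)
next
  fix x y and u v :: real
  assume "x \<in> S" "y \<in> S" "0 \<le> u" "0 \<le> v" "u + v = 1"
  then consider "u = 0" "v = 1" | "u = 1" "v = 0" | "x = y" | "0 < u" "0 < v" "x \<noteq> y"
    by fastforce
  then show "f (u *\<^sub>R x + v *\<^sub>R y) \<le> u * f x + v * f y"
  proof cases
    case 3
    then show ?thesis using \<open>u + v = 1\<close>
      by (metis order_refl distrib_right mult_1 scaleR_add_left scaleR_one)
  next
    case 4
    then show ?thesis
      using assms \<open>x \<in> S\<close> \<open>y \<in> S\<close> \<open>u + v = 1\<close>
      unfolding strictly_convex_on_def by (meson less_imp_le)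
  qed auto
qed

lemma max_zero_convex_combination_le:
  fixes s t \<kappa> :: real
  assumes "0 \<le> \<kappa>" "\<kappa> \<le> 1"
  shows "max (\<kappa> * s + (1 - \<kappa>) * t) 0 \<le> \<kappa> * max s 0 + (1 - \<kappa>) * max t 0"
proof -
  have "\<kappa> * s \<le> \<kappa> * max s 0" "(1 - \<kappa>) * t \<le> (1 - \<kappa>) * max t 0"
    "0 \<le> \<kappa> * max s 0" "0 \<le> (1 - \<kappa>) * max t 0"
    using assms by (auto intro: mult_left_mono)
  then show ?thesis by linarith
qed

text \<open>For fixed \<open>x\<close> the arguments of both positive parts are affine jointly in
  \<open>u\<close>, \<open>w\<close> and the value \<open>c x\<close>, so their positive parts are
  convex and the nonnegative coefficients preserve this. The first term is a convex increasing
  function of the convex distance to \<open>chat\<close>.\<close>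

lemma F_convex:
  assumes g: "mono_on {0..1} g" "convex_on {0..1} g"
    and chat: "0 \<le> chat" "chat \<le> 1"
    and c: "0 \<le> c\<^sub>1 x" "c\<^sub>1 x \<le> 1" "0 \<le> c\<^sub>2 x" "c\<^sub>2 x \<le> 1"
    and coeffs: "0 \<le> lam / \<alpha>" "0 \<le> \<eta> / (1 - \<beta>)"
    and \<kappa>: "0 \<le> \<kappa>" "\<kappa> \<le> 1"
  shows "F g chat \<alpha> \<beta> lam \<eta> x (\<kappa> * u\<^sub>1 + (1 - \<kappa>) * u\<^sub>2) (\<kappa> * w\<^sub>1 + (1 - \<kappa>) * w\<^sub>2)
            (\<lambda>x. \<kappa> * c\<^sub>1 x + (1 - \<kappa>) * c\<^sub>2 x)
    \<le> \<kappa> * F g chat \<alpha> \<beta> lam \<eta> x u\<^sub>1 w\<^sub>1 c\<^sub>1 + (1 - \<kappa>) * F g chat \<alpha> \<beta> lam \<eta> x u\<^sub>2 w\<^sub>2 c\<^sub>2"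
proof -
  let ?d\<^sub>1 = "\<bar>c\<^sub>1 x - chat\<bar>" and ?d\<^sub>2 = "\<bar>c\<^sub>2 x - chat\<bar>"
  let ?c = "\<kappa> * c\<^sub>1 x + (1 - \<kappa>) * c\<^sub>2 x"
  have d: "?d\<^sub>1 \<in> {0..1}" "?d\<^sub>2 \<in> {0..1}" using c chat by (auto simp: abs_le_iff)
  \<comment> \<open>Monotonicity of \<open>g\<close> is known on the unit interval only, so the
    combined distance must be shown to stay there.\<close>
  have comb: "\<kappa> * ?d\<^sub>1 + (1 - \<kappa>) * ?d\<^sub>2 \<in> {0..1}"
    using convexD[OF convex_real_interval(5) d, of \<kappa> "1 - \<kappa>"] \<kappa> by simp
  have "\<bar>?c - chat\<bar> = \<bar>\<kappa> * (c\<^sub>1 x - chat) + (1 - \<kappa>) * (c\<^sub>2 x - chat)\<bar>"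
    by (simp add: algebra_simps)
  also have "\<dots> \<le> \<kappa> * ?d\<^sub>1 + (1 - \<kappa>) * ?d\<^sub>2"
    using \<kappa> abs_triangle_ineq[of "\<kappa> * (c\<^sub>1 x - chat)" "(1 - \<kappa>) * (c\<^sub>2 x - chat)"] by (simp add: abs_mult)
  finally have "g \<bar>?c - chat\<bar> \<le> g (\<kappa> * ?d\<^sub>1 + (1 - \<kappa>) * ?d\<^sub>2)"
    using comb by (intro mono_onD[OF g(1)]) auto
  also have "\<dots> \<le> \<kappa> * g ?d\<^sub>1 + (1 - \<kappa>) * g ?d\<^sub>2"
    using convex_onD[OF g(2), of "1 - \<kappa>" ?d\<^sub>1 ?d\<^sub>2] d \<kappa> by simp
  finally have 1: "g \<bar>?c - chat\<bar> \<le> \<kappa> * g ?d\<^sub>1 + (1 - \<kappa>) * g ?d\<^sub>2" .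
  have "\<kappa> * u\<^sub>1 + (1 - \<kappa>) * u\<^sub>2 - (1 - ?c) * x
      = \<kappa> * (u\<^sub>1 - (1 - c\<^sub>1 x) * x) + (1 - \<kappa>) * (u\<^sub>2 - (1 - c\<^sub>2 x) * x)"
    by (simp add: algebra_simps)
  then have 2: "lam / \<alpha> * max (\<kappa> * u\<^sub>1 + (1 - \<kappa>) * u\<^sub>2 - (1 - ?c) * x) 0
      \<le> lam / \<alpha> * (\<kappa> * max (u\<^sub>1 - (1 - c\<^sub>1 x) * x) 0 + (1 - \<kappa>) * max (u\<^sub>2 - (1 - c\<^sub>2 x) * x) 0)"
    using max_zero_convex_combination_le[OF \<kappa>] coeffs by (simp only: mult_left_mono)
  have "(1 - ?c) * x - (\<kappa> * w\<^sub>1 + (1 - \<kappa>) * w\<^sub>2)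
      = \<kappa> * ((1 - c\<^sub>1 x) * x - w\<^sub>1) + (1 - \<kappa>) * ((1 - c\<^sub>2 x) * x - w\<^sub>2)"
    by (simp add: algebra_simps)
  then have 3: "\<eta> / (1 - \<beta>) * max ((1 - ?c) * x - (\<kappa> * w\<^sub>1 + (1 - \<kappa>) * w\<^sub>2)) 0
      \<le> \<eta> / (1 - \<beta>) * (\<kappa> * max ((1 - c\<^sub>1 x) * x - w\<^sub>1) 0 + (1 - \<kappa>) * max ((1 - c\<^sub>2 x) * x - w\<^sub>2) 0)"
    using max_zero_convex_combination_le[OF \<kappa>] coeffs by (simp only: mult_left_mono)
  show ?thesis
    using 1 2 3 unfolding F_def distrib_left mult.left_commute[of \<kappa>] mult.left_commute[of "1 - \<kappa>"]
    by linarith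
qed

text \<open>Supplies the sign condition in \<open>G_dom\<close>.\<close>

lemma F_nonneg:
  assumes "\<forall>t\<in>{0..1}. 0 \<le> g t" "0 \<le> chat" "chat \<le> 1" "0 \<le> c x" "c x \<le> 1"
    and "0 \<le> lam / \<alpha>" "0 \<le> \<eta> / (1 - \<beta>)"
  shows "0 \<le> F g chat \<alpha> \<beta> lam \<eta> x u w c"
proof -
  have "\<bar>c x - chat\<bar> \<in> {0..1}" using assms by (auto simp: abs_le_iff)
  then have "0 \<le> g \<bar>c x - chat\<bar>" using assms(1) by blast
  moreover have "0 \<le> lam / \<alpha> * max (u - (1 - c x) * x) 0"
    "0 \<le> \<eta> / (1 - \<beta>) * max ((1 - c x) * x - w) 0"
    using assms by (intro mult_nonneg_nonneg; simp)+
  ultimately show ?thesis unfolding F_def by linarith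
qed

text \<open>The quantity \<open>(1 - c x) * x\<close> lies between 0 and \<open>x\<close>, so the
  first positive part is at most \<open>u\<close> and the second at most \<open>x\<close>. The bound
  is uniform in \<open>c\<close> and \<open>w\<close> and grows linearly in \<open>x\<close>, which
  an exponential moment of \<open>p\<close> can absorb.\<close>

lemma F_le:
  assumes "mono_on {0..1} g" "0 \<le> chat" "chat \<le> 1" "0 \<le> c x" "c x \<le> 1"
    and "0 \<le> lam / \<alpha>" "0 \<le> \<eta> / (1 - \<beta>)" "0 \<le> x" "0 \<le> u" "0 \<le> w"
  shows "F g chat \<alpha> \<beta> lam \<eta> x u w c \<le> g 1 + lam / \<alpha> * u + \<eta> / (1 - \<beta>) * x"
proof -
  have "\<bar>c x - chat\<bar> \<in> {0..1}" using assms by (auto simp: abs_le_iff)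
  then have "g \<bar>c x - chat\<bar> \<le> g 1" using assms(1) by (auto intro: mono_onD)
  moreover have "0 \<le> (1 - c x) * x" "(1 - c x) * x \<le> x"
    using assms by (auto intro: mult_left_le_one_le)
  then have "lam / \<alpha> * max (u - (1 - c x) * x) 0 \<le> lam / \<alpha> * u"
    "\<eta> / (1 - \<beta>) * max ((1 - c x) * x - w) 0 \<le> \<eta> / (1 - \<beta>) * x"
    using assms by (intro mult_left_mono; simp)+
  ultimately show ?thesis unfolding F_def by linarith
qed

lemma F_measurable:
  assumes g: "continuous_on {0..1} g" and chat: "0 \<le> chat" "chat \<le> 1"
    and c: "c \<in> contracts X p"
  shows "(\<lambda>x. F g chat \<alpha> \<beta> lam \<eta> x u w c) \<in> borel_measurable (lebesgue_on {X<..})"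
proof -
  have [measurable]: "c \<in> borel_measurable (lebesgue_on {X<..})"
    "(\<lambda>x. x) \<in> borel_measurable (lebesgue_on {X<..})"
    using c by (auto simp: contracts_def measurable_completion intro!: measurable_restrict_space1)
  \<comment> \<open>Outside the unit interval \<open>g\<close> is arbitrary. Clamping its argument
    gives a function continuous on the whole line, hence Borel, which agrees with \<open>g\<close>
    at every distance that occurs.\<close>
  have "continuous_on UNIV (\<lambda>t. g (max 0 (min 1 t)))"
    by (intro continuous_on_compose2[OF g] continuous_intros) auto
  then have [measurable]: "(\<lambda>t. g (max 0 (min 1 t))) \<in> borel_measurable borel"
    by (rule borel_measurable_continuous_onI)
  have "(\<lambda>x. g (max 0 (min 1 \<bar>c x - chat\<bar>)) + lam / \<alpha> * max (u - (1 - c x) * x) 0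
       + \<eta> / (1 - \<beta>) * max ((1 - c x) * x - w) 0) \<in> borel_measurable (lebesgue_on {X<..})"
    by measurable
  moreover have "max 0 (min 1 \<bar>c x - chat\<bar>) = \<bar>c x - chat\<bar>" if "x \<in> space (lebesgue_on {X<..})" for x
  proof -
    have "0 \<le> c x" "c x \<le> 1" using c that by (auto simp: contracts_def)
    then show ?thesis using chat by (simp add: abs_le_iff)
  qed
  ultimately show ?thesis
    unfolding F_def by (subst measurable_cong) auto
qed

section \<open>Convexity of the feasible set, then finiteness and convexity of
  \<open>H\<close>\<close>

lemma contracts_convex_combination:
  assumes p: "\<forall>x\<in>{X<..}. 0 \<le> p x" "integrable (lebesgue_on {X<..}) p"
    and c: "c\<^sub>1 \<in> contracts X p" "c\<^sub>2 \<in> contracts X p" and \<kappa>: "0 \<le> \<kappa>" "\<kappa> \<le> 1"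
  shows "(\<lambda>x. \<kappa> * c\<^sub>1 x + (1 - \<kappa>) * c\<^sub>2 x) \<in> contracts X p"
proof -
  let ?c = "\<lambda>x. \<kappa> * c\<^sub>1 x + (1 - \<kappa>) * c\<^sub>2 x"
  have meas: "?c \<in> borel_measurable (lebesgue_on {X<..})"
    using c unfolding contracts_def by auto
  have range: "?c x \<in> {0..1}" if "x \<in> {X<..}" for x
    using convexD[OF convex_real_interval(5)[of 0 1], of "c\<^sub>1 x" "c\<^sub>2 x" \<kappa> "1 - \<kappa>"] c \<kappa> that
    by (auto simp: contracts_def)
  \<comment> \<open>Values in the unit interval have squares at most 1, so the density
    \<open>p\<close> itself is an integrable bound.\<close>
  have "integrable (lebesgue_on {X<..}) (\<lambda>x. (?c x)\<^sup>2 * p x)"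
  proof (rule Bochner_Integration.integrable_bound[OF p(2)])
    show "(\<lambda>x. (?c x)\<^sup>2 * p x) \<in> borel_measurable (lebesgue_on {X<..})"
      using meas p(2) by (intro borel_measurable_times borel_measurable_power) auto
    show "AE x in lebesgue_on {X<..}. norm ((?c x)\<^sup>2 * p x) \<le> norm (p x)"
    proof (rule AE_I2)
      fix x assume "x \<in> space (lebesgue_on {X<..})"
      then have "(?c x)\<^sup>2 \<le> 1" "0 \<le> p x"
        using range[of x] p(1) by (auto simp: power_le_one)
      then show "norm ((?c x)\<^sup>2 * p x) \<le> norm (p x)"
        by (simp add: abs_mult mult_left_le_one_le)
    qed
  qed
  then show ?thesis
    using meas range unfolding contracts_def L2p_def by auto
qed

lemma convex_feasible:
  assumes "\<forall>x\<in>{X<..}. 0 \<le> p x" "integrable (lebesgue_on {X<..}) p"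
  shows "convex (feasible X p)"
proof -
  have "convex (contracts X p)"
  proof (rule convexI)
    fix c d and u v :: real
    assume *: "c \<in> contracts X p" "d \<in> contracts X p" "0 \<le> u" "0 \<le> v" "u + v = 1"
    then have "u *\<^sub>R c + v *\<^sub>R d = (\<lambda>x. u * c x + (1 - u) * d x)"
      by (auto simp: fun_eq_iff)
    then show "u *\<^sub>R c + v *\<^sub>R d \<in> contracts X p"
      using contracts_convex_combination[OF assms *(1,2), of u] * by simp
  qed
  then show ?thesis
    unfolding feasible_def by (intro convex_Times convex_real_interval)
qed

text \<open>By the linear bound on \<open>F\<close>, the integrand is at most a constant times
  \<open>exp (C * x) * p x\<close>, whose integrability is assumed. The condition on
  \<open>C\<close> says that it is at least the growth rate of \<open>F / \<mu>\<close> in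
  \<open>x\<close>.\<close>

lemma exp_F_G_dom:
  assumes X: "0 \<le> X" and p: "\<forall>x\<in>{X<..}. 0 \<le> p x" "p \<in> borel_measurable (lebesgue_on {X<..})"
    and g: "continuous_on {0..1} g" "\<forall>t\<in>{0..1}. 0 \<le> g t" "mono_on {0..1} g"
    and chat: "0 \<le> chat" "chat \<le> 1"
    and coeffs: "0 \<le> lam / \<alpha>" "0 \<le> \<eta> / (1 - \<beta>)" and \<mu>: "0 < \<mu>"
    and int: "integrable (lebesgue_on {X<..}) (\<lambda>x. exp (C * x) * p x)"
    and C: "\<eta> / (1 - \<beta>) / \<mu> \<le> C"
    and uw: "0 \<le> u" "0 \<le> w" and c: "c \<in> contracts X p"
  shows "(\<lambda>x. F g chat \<alpha> \<beta> lam \<eta> x u w c / \<mu>) \<in> G_dom X p"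
proof -
  let ?f = "\<lambda>x. F g chat \<alpha> \<beta> lam \<eta> x u w c / \<mu>"
  have meas: "?f \<in> borel_measurable (lebesgue_on {X<..})"
    using F_measurable[OF g(1) chat c] by simp
  \<comment> \<open>The part of the upper bound on \<open>F / \<mu>\<close> that does not depend on
    \<open>x\<close>; \<open>exp K\<close> becomes the constant factor of the dominating
    function.\<close>
  define K where "K = (g 1 + lam / \<alpha> * u) / \<mu>"
  have range: "0 \<le> c x" "c x \<le> 1" if "x \<in> {X<..}" for x
    using c that by (auto simp: contracts_def)
  have le: "?f x \<le> K + C * x" if x: "x \<in> {X<..}" for x
  proof -
    have "0 \<le> x" using x X by simp
    then have "?f x \<le> (g 1 + lam / \<alpha> * u + \<eta> / (1 - \<beta>) * x) / \<mu>"
      using F_le[where c=c and x=x] g chat range[OF x] coeffs uw \<mu> by (intro divide_right_mono) auto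
    also have "\<dots> = K + \<eta> / (1 - \<beta>) / \<mu> * x"
      by (simp add: K_def add_divide_distrib)
    also have "\<dots> \<le> K + C * x"
      using C \<open>0 \<le> x\<close> by (intro add_left_mono mult_right_mono)
    finally show ?thesis .
  qed
  have "integrable (lebesgue_on {X<..}) (\<lambda>x. exp (?f x) * p x)"
  proof (rule Bochner_Integration.integrable_bound)
    show "integrable (lebesgue_on {X<..}) (\<lambda>x. exp K * (exp (C * x) * p x))"
      using int by simp
    show "(\<lambda>x. exp (?f x) * p x) \<in> borel_measurable (lebesgue_on {X<..})"
      using meas p(2) by measurable
    show "AE x in lebesgue_on {X<..}. norm (exp (?f x) * p x) \<le> norm (exp K * (exp (C * x) * p x))"
    proof (rule AE_I2)
      fix x assume "x \<in> space (lebesgue_on {X<..})"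
      then have x: "x \<in> {X<..}" by simp
      have "exp (?f x) * p x \<le> exp (K + C * x) * p x"
        using le[OF x] p(1) x by (intro mult_right_mono) auto
      then show "norm (exp (?f x) * p x) \<le> norm (exp K * (exp (C * x) * p x))"
        using p(1) x by (simp add: abs_mult exp_add mult.assoc)
    qed
  qed
  moreover have "0 \<le> ?f x" if "x \<in> {X<..}" for x
    using F_nonneg[where c=c and x=x] g chat range[OF that] coeffs \<mu> by simp
  ultimately show ?thesis using meas unfolding G_dom_def by auto
qed

text \<open>Pointwise convexity of \<open>F\<close>, then \<open>G_mono\<close>, then
  \<open>G_convex\<close>, and finally scaling by the positive \<mu>. The assumption
  \<open>dom\<close> isolates the integrability question, so that the exponential moment does not
  enter here.\<close>

lemma H_convex:
  assumes p: "\<forall>x\<in>{X<..}. 0 \<le> p x" "integrable (lebesgue_on {X<..}) p"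
      "(LINT x|lebesgue_on {X<..}. p x) = 1"
    and g: "mono_on {0..1} g" "convex_on {0..1} g"
    and chat: "0 \<le> chat" "chat \<le> 1"
    and coeffs: "0 \<le> lam / \<alpha>" "0 \<le> \<eta> / (1 - \<beta>)" and \<mu>: "0 < \<mu>"
    and dom: "\<And>u w c. 0 \<le> u \<Longrightarrow> 0 \<le> w \<Longrightarrow> c \<in> contracts X p \<Longrightarrow>
      (\<lambda>x. F g chat \<alpha> \<beta> lam \<eta> x u w c / \<mu>) \<in> G_dom X p"
    and uw: "0 \<le> u\<^sub>1" "0 \<le> u\<^sub>2" "0 \<le> w\<^sub>1" "0 \<le> w\<^sub>2"
    and c: "c\<^sub>1 \<in> contracts X p" "c\<^sub>2 \<in> contracts X p" and \<kappa>: "0 \<le> \<kappa>" "\<kappa> \<le> 1"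
  shows "H X p g chat \<alpha> \<beta> lam \<eta> \<mu>
          (\<kappa> * u\<^sub>1 + (1 - \<kappa>) * u\<^sub>2) (\<kappa> * w\<^sub>1 + (1 - \<kappa>) * w\<^sub>2) (\<lambda>x. \<kappa> * c\<^sub>1 x + (1 - \<kappa>) * c\<^sub>2 x)
      \<le> \<kappa> * H X p g chat \<alpha> \<beta> lam \<eta> \<mu> u\<^sub>1 w\<^sub>1 c\<^sub>1 + (1 - \<kappa>) * H X p g chat \<alpha> \<beta> lam \<eta> \<mu> u\<^sub>2 w\<^sub>2 c\<^sub>2"
proof -
  let ?\<theta> = "\<lambda>x. F g chat \<alpha> \<beta> lam \<eta> x (\<kappa> * u\<^sub>1 + (1 - \<kappa>) * u\<^sub>2) (\<kappa> * w\<^sub>1 + (1 - \<kappa>) * w\<^sub>2)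
    (\<lambda>x. \<kappa> * c\<^sub>1 x + (1 - \<kappa>) * c\<^sub>2 x) / \<mu>"
  let ?\<theta>\<^sub>1 = "\<lambda>x. F g chat \<alpha> \<beta> lam \<eta> x u\<^sub>1 w\<^sub>1 c\<^sub>1 / \<mu>" and ?\<theta>\<^sub>2 = "\<lambda>x. F g chat \<alpha> \<beta> lam \<eta> x u\<^sub>2 w\<^sub>2 c\<^sub>2 / \<mu>"
  have \<theta>: "?\<theta> \<in> G_dom X p" "?\<theta>\<^sub>1 \<in> G_dom X p" "?\<theta>\<^sub>2 \<in> G_dom X p"
    using dom uw c \<kappa> contracts_convex_combination[OF p(1,2) c \<kappa>] by auto
  have "?\<theta> x \<le> \<kappa> * ?\<theta>\<^sub>1 x + (1 - \<kappa>) * ?\<theta>\<^sub>2 x" if "x \<in> {X<..}" for x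
  proof -
    have "0 \<le> c\<^sub>1 x" "c\<^sub>1 x \<le> 1" "0 \<le> c\<^sub>2 x" "c\<^sub>2 x \<le> 1"
      using c that by (auto simp: contracts_def)
    from divide_right_mono[OF F_convex[where x=x and c\<^sub>1=c\<^sub>1 and c\<^sub>2=c\<^sub>2, OF g chat this coeffs \<kappa>], of \<mu>] \<mu>
    show ?thesis by (simp add: add_divide_distrib)
  qed
  then have "G X p ?\<theta> \<le> G X p (\<lambda>x. \<kappa> * ?\<theta>\<^sub>1 x + (1 - \<kappa>) * ?\<theta>\<^sub>2 x)"
    using p \<theta> \<kappa> by (intro G_mono[OF p] G_dom_convex_combination) auto
  also have "\<dots> \<le> \<kappa> * G X p ?\<theta>\<^sub>1 + (1 - \<kappa>) * G X p ?\<theta>\<^sub>2"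
    by (rule G_convex[OF p \<theta>(2,3) \<kappa>])
  finally have "\<mu> * G X p ?\<theta> \<le> \<mu> * (\<kappa> * G X p ?\<theta>\<^sub>1 + (1 - \<kappa>) * G X p ?\<theta>\<^sub>2)"
    using \<mu> by (intro mult_left_mono) auto
  then show ?thesis unfolding H_eq_G by (simp add: algebra_simps)
qed

text \<open>The conjuncts on membership in \<open>G_dom\<close> and on integrability ensure that the
  inequalities compare genuine finite integrals and not the default value 0 of a divergent
  one.\<close>

theorem proposition6:
  fixes X \<alpha> \<beta> chat lam \<eta> \<mu> C_X :: real
    and p g :: "real \<Rightarrow> real"
  assumes "X \<ge> 0"
    and "continuous_on {X<..} p" and "bounded (p ` {X<..})"
    and "\<forall>x\<in>{X<..}. p x > 0"
    and "integrable (lebesgue_on {X<..}) p" and "(LINT x|lebesgue_on {X<..}. p x) = 1"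
    and "0 < \<alpha>" "\<alpha> < 1" and "0 < \<beta>" "\<beta> < 1"
    and "0 \<le> chat" "chat \<le> 1"
    and "lam \<ge> 0" and "\<eta> \<ge> 0" and "\<mu> > 0"
    and "\<forall>t\<in>{0..1}. g t \<ge> 0"
    and "C2_on {0..1} g"
    and "mono_on {0..1} g"
    and "strictly_convex_on {0..1} g"
    and "\<exists>L. L-lipschitz_on {0..1} g"
    and "C_X = 2 * \<eta> / (\<mu> * (1 - \<beta>))" and "C_X > 0"
    and "\<forall>k\<in>{0, 1, 2::nat}. integrable (lebesgue_on {X<..}) (\<lambda>x. x ^ k * exp (C_X * x) * p x)"
  shows "(\<forall>\<theta>\<^sub>1\<in>G_dom X p. \<forall>\<theta>\<^sub>2\<in>G_dom X p. \<forall>\<kappa>\<in>{0..1}.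
            (\<lambda>x. \<kappa> * \<theta>\<^sub>1 x + (1 - \<kappa>) * \<theta>\<^sub>2 x) \<in> G_dom X p \<and>
            G X p (\<lambda>x. \<kappa> * \<theta>\<^sub>1 x + (1 - \<kappa>) * \<theta>\<^sub>2 x) \<le> \<kappa> * G X p \<theta>\<^sub>1 + (1 - \<kappa>) * G X p \<theta>\<^sub>2)
       \<and> (\<forall>u\<ge>0. \<forall>w\<ge>0. \<forall>c\<in>contracts X p.
            integrable (lebesgue_on {X<..}) (\<lambda>x. exp (F g chat \<alpha> \<beta> lam \<eta> x u w c / \<mu>) * p x))
       \<and> (\<forall>u\<^sub>1\<ge>0. \<forall>u\<^sub>2\<ge>0. \<forall>w\<^sub>1\<ge>0. \<forall>w\<^sub>2\<ge>0. \<forall>c\<^sub>1\<in>contracts X p. \<forall>c\<^sub>2\<in>contracts X p. \<forall>\<kappa>\<in>{0..1}.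
            H X p g chat \<alpha> \<beta> lam \<eta> \<mu>
              (\<kappa> * u\<^sub>1 + (1 - \<kappa>) * u\<^sub>2) (\<kappa> * w\<^sub>1 + (1 - \<kappa>) * w\<^sub>2) (\<lambda>x. \<kappa> * c\<^sub>1 x + (1 - \<kappa>) * c\<^sub>2 x)
            \<le> \<kappa> * H X p g chat \<alpha> \<beta> lam \<eta> \<mu> u\<^sub>1 w\<^sub>1 c\<^sub>1
              + (1 - \<kappa>) * H X p g chat \<alpha> \<beta> lam \<eta> \<mu> u\<^sub>2 w\<^sub>2 c\<^sub>2)
       \<and> convex (feasible X p)
       \<and> convex_on (feasible X p) (objective X p g chat \<alpha> \<beta> lam \<eta> \<mu>)"
proof -
  have p: "\<forall>x\<in>{X<..}. 0 \<le> p x" using assms(4) by (meson less_imp_le)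
  note p_int = assms(5,6)
  have g_cont: "continuous_on {0..1} g" using assms(20) lipschitz_on_continuous_on by blast
  have g_convex: "convex_on {0..1} g" using assms(19) by (rule strictly_convex_on_imp_convex_on)
  have coeffs: "0 \<le> lam / \<alpha>" "0 \<le> \<eta> / (1 - \<beta>)" using assms by auto
  have C: "\<eta> / (1 - \<beta>) / \<mu> \<le> C_X"
  proof -
    \<comment> \<open>\<open>C_X\<close> is twice the growth rate of \<open>F / \<mu>\<close>; being
      positive, it exceeds its own half.\<close>
    have "C_X = 2 * (\<eta> / (1 - \<beta>) / \<mu>)" using assms(21) by (simp add: mult.commute)
    then show ?thesis using assms(22) by linarith
  qed
  have int: "integrable (lebesgue_on {X<..}) (\<lambda>x. exp (C_X * x) * p x)"
    \<comment> \<open>The moment with \<open>k = 0\<close> is the dominating function for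
      \<open>F\<close>.\<close>
    using bspec[OF assms(23), of 0] by simp
  have dom: "(\<lambda>x. F g chat \<alpha> \<beta> lam \<eta> x u w c / \<mu>) \<in> G_dom X p"
    if "0 \<le> u" "0 \<le> w" "c \<in> contracts X p" for u w c
    using assms p g_cont coeffs C int that by (intro exp_F_G_dom) auto
  note H = H_convex[OF p p_int assms(18) g_convex assms(11,12) coeffs assms(15) dom]
  have "convex_on (feasible X p) (objective X p g chat \<alpha> \<beta> lam \<eta> \<mu>)"
    unfolding convex_on_def
  proof (intro conjI ballI allI impI)
    show "convex (feasible X p)" using convex_feasible[OF p p_int(1)] .
  next
    fix y z and a b :: real
    assume y: "y \<in> feasible X p" and z: "z \<in> feasible X p" and ab: "0 \<le> a" "0 \<le> b" "a + b = 1"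
    obtain u\<^sub>1 w\<^sub>1 c\<^sub>1 u\<^sub>2 w\<^sub>2 c\<^sub>2 where yz: "y = (u\<^sub>1, w\<^sub>1, c\<^sub>1)" "z = (u\<^sub>2, w\<^sub>2, c\<^sub>2)"
      by (metis prod.exhaust)
    have b: "b = 1 - a" using ab by simp
    \<comment> \<open>The pointwise vector space structure turns the abstract combination into the
      one in the inequality for \<open>H\<close>. The remaining terms of the objective are linear in
      \<open>u\<close> and \<open>w\<close> and contribute equally to both sides.\<close>
    have "a *\<^sub>R c\<^sub>1 + b *\<^sub>R c\<^sub>2 = (\<lambda>x. a * c\<^sub>1 x + (1 - a) * c\<^sub>2 x)"
      by (simp add: fun_eq_iff b)
    then show "objective X p g chat \<alpha> \<beta> lam \<eta> \<mu> (a *\<^sub>R y + b *\<^sub>R z)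
        \<le> a * objective X p g chat \<alpha> \<beta> lam \<eta> \<mu> y + b * objective X p g chat \<alpha> \<beta> lam \<eta> \<mu> z"
      using H[of u\<^sub>1 u\<^sub>2 w\<^sub>1 w\<^sub>2 c\<^sub>1 c\<^sub>2 a] y z ab
      by (simp add: yz feasible_def objective_def b algebra_simps)
  qed
  then show ?thesis
    using G_convex[OF p p_int] G_dom_convex_combination[OF p] p_int(1) dom H convex_feasible[OF p p_int(1)]
    by (auto simp: G_dom_def)
qed

end
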